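(* The competitive equilibrium in the two-stage market with a day-ahead MPM policy exists and is given by \begin{align*} &g_j^d=\frac{c_j^{-1}}{\sum_{k\in\mathcal{G}}c_k^{-1}}\,d,\qquad g_j^r=0,\qquad \beta_j^r=\frac{b^r}{\sum_{k\in\mathcal{G}}c_k^{-1}}\,d,\quad\forall j\in\mathcal{G},\\ &d_l^d+d_l^r=d_l\ \ \forall l\in\mathcal{L},\qquad d^d=d,\qquad d^r=0,\\ &\lambda^d=\lambda^r=\frac{d}{\sum_{k\in\mathcal{G}}c_k^{-1}}. \end{align*}
   Context: Market: $\mathcal{G}$ (generators) and $\mathcal{L}$ (loads) are finite nonempty sets. Generator $j$ has cost $\frac{c_j}{2}g_j^2$, $c_j>0$, for total dispatch $g_j=g_j^d+g_j^r$ (day-ahead plus real-time dispatch, real numbers). Load $l$ has fixed inelastic demand $d_l>0$ split as $d_l=d_l^d+d_l^r$ with $d_l^d,d_l^r\in\mathbb{R}$; $d:=\sum_l d_l$, $d^d:=\sum_ld_l^d$, $d^r:=\sum_ld_l^r$. Day-ahead MPM (market power mitigation) policy: in the day-ahead market, generator bids are replaced by true costs, so $g_j^d=c_j^{-1}\lambda^d$ for all $j$, and by day-ahead power balance $\sum_jg_j^d=d^d$, $\lambda^d=d^d/\sum_{k\in\mathcal{G}}c_k^{-1}$. Real-time market: with fixed slope $b^r>0$, generator $j$ bids $\beta_j^r\in\mathbb{R}$, meaning $g_j^r=b^r\lambda^r-\beta_j^r$; the market clears when $\sum_j(b^r\lambda^r-\beta_j^r)=d^r$. Price-taking participants: given $\lambda^r$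 (and the day-ahead outcome), generator $j$ chooses $\beta_j^r\in\mathbb{R}$ to maximize its profit $\lambda^rg_j^r+\lambda^dg_j^d-\frac{c_j}{2}(g_j^d+g_j^r)^2$ with $g_j^d=\frac{c_j^{-1}d^d}{\sum_kc_k^{-1}}$ and $g_j^r=b^r\lambda^r-\beta_j^r$, i.e. (up to additive constants) solves $$\max_{\beta_j^r}\ -\beta_j^r\lambda^r-\frac{c_j}{2}\left(\frac{c_j^{-1}d^d}{\sum_kc_k^{-1}}+b^r\lambda^r-\beta_j^r\right)^2;$$ given $(\lambda^d,\lambda^r)$, load $l$ chooses $d_l^d\in\mathbb{R}$ to minimize $\lambda^dd_l^d+\lambda^r(d_l-d_l^d)$, with $d_l^r=d_l-d_l^d$. Competitive equilibrium: bids, allocations and prices such that each participant solves its individual problem with prices taken as given, the day-ahead dispatch and price follow the policy rule, and the real-time market clears. *)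

theory Defs
  imports Complex_Main
begin

text \<open>
  Generators and loads are the elements of finite sets \<open>G\<close> and \<open>L\<close>; the functions below are
  only constrained on these sets. \<open>c\<close> gives the cost coefficients, \<open>dem\<close> the inelastic
  demands and \<open>br\<close> the slope of the real-time bids.
\<close>

record ('g, 'l) market_outcome =
  gen_da :: "'g \<Rightarrow> real"
  gen_rt :: "'g \<Rightarrow> real"
  bid_rt :: "'g \<Rightarrow> real"
  load_da :: "'l \<Rightarrow> real"
  load_rt :: "'l \<Rightarrow> real"
  price_da :: real
  price_rt :: real

text \<open>True-cost dispatch together with day-ahead power balance.\<close>

definition mpm_day_ahead :: "'g set \<Rightarrow> 'l set \<Rightarrow> ('g \<Rightarrow> real) \<Rightarrow> ('g, 'l) market_outcome \<Rightarrow> bool" where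
  "mpm_day_ahead G L c x \<longleftrightarrow>
     (\<forall>j\<in>G. gen_da x j = inverse (c j) * price_da x) \<and>
     (\<Sum>j\<in>G. gen_da x j) = (\<Sum>l\<in>L. load_da x l)"

definition rt_supply :: "real \<Rightarrow> real \<Rightarrow> real \<Rightarrow> real" where
  "rt_supply br pr \<beta> = br * pr - \<beta>"

definition rt_clearing :: "'g set \<Rightarrow> 'l set \<Rightarrow> real \<Rightarrow> ('g, 'l) market_outcome \<Rightarrow> bool" where
  "rt_clearing G L br x \<longleftrightarrow>
     (\<forall>j\<in>G. gen_rt x j = rt_supply br (price_rt x) (bid_rt x j)) \<and>
     (\<Sum>j\<in>G. rt_supply br (price_rt x) (bid_rt x j)) = (\<Sum>l\<in>L. load_rt x l)"

text \<open>
  Profit of generator \<open>j\<close> as a function of its bid \<open>\<beta>\<close>, at day-ahead price \<open>pd\<close> and real-time price \<open>pr\<close>. Its day-ahead dispatch is the one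
  that the policy assigns to it when the total day-ahead demand is \<open>D\<close>; the bid affects only
  the real-time dispatch.
\<close>

definition gen_profit ::
  "'g set \<Rightarrow> ('g \<Rightarrow> real) \<Rightarrow> real \<Rightarrow> real \<Rightarrow> real \<Rightarrow> real \<Rightarrow> 'g \<Rightarrow> real \<Rightarrow> real" where
  "gen_profit G c br D pd pr j \<beta> =
     (let gd = inverse (c j) * D / (\<Sum>k\<in>G. inverse (c k));
          gr = rt_supply br pr \<beta>
      in pr * gr + pd * gd - c j / 2 * (gd + gr)\<^sup>2)"

definition load_payment :: "real \<Rightarrow> real \<Rightarrow> real \<Rightarrow> real \<Rightarrow> real" where
  "load_payment pd pr \<delta> y = pd * y + pr * (\<delta> - y)"

definition competitive_equilibrium ::
  "'g set \<Rightarrow> 'l set \<Rightarrow> ('g \<Rightarrow> real) \<Rightarrow> ('l \<Rightarrow> real) \<Rightarrow> real \<Rightarrow> ('g, 'l) market_outcome \<Rightarrow> bool" where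
  "competitive_equilibrium G L c dem br x \<longleftrightarrow>
     (\<forall>j\<in>G. is_arg_max
        (gen_profit G c br (\<Sum>l\<in>L. load_da x l) (price_da x) (price_rt x) j)
        (\<lambda>_. True) (bid_rt x j)) \<and>
     (\<forall>l\<in>L. is_arg_min (load_payment (price_da x) (price_rt x) (dem l)) (\<lambda>_. True) (load_da x l) \<and>
        load_rt x l = dem l - load_da x l) \<and>
     mpm_day_ahead G L c x \<and>
     rt_clearing G L br x"

end

theory Submission
  imports Defs
begin

text \<open>
  A load faces an objective that is affine in its day-ahead demand, so an optimum exists only if
  the two prices agree. A generator equates marginal cost with the real-time price. Since the
  policy already equates marginal cost with the day-ahead price, equal prices leave no real-time
  dispatch; then real-time demand sums to zero and all demand is served day-ahead.
\<close>

text \<open>The vertex \<open>m\<close> beats any other point \<open>y\<close> by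
  \<open>a * (y - m)\<^sup>2\<close>, so comparison with \<open>m\<close> alone decides
  optimality.\<close>

lemma is_arg_max_concave_quadratic_iff:
  fixes f :: "real \<Rightarrow> real"
  assumes "a > 0" and f: "\<And>y. f y = K - a * (y - m)\<^sup>2"
  shows "is_arg_max f (\<lambda>_. True) x \<longleftrightarrow> x = m"
proof
  assume "is_arg_max f (\<lambda>_. True) x"
  then have "\<not> f m > f x"
    by (simp add: is_arg_max_def)
  then have "a * (x - m)\<^sup>2 \<le> 0"
    by (simp add: f)
  with \<open>a > 0\<close> show "x = m"
    by (simp add: mult_le_0_iff)
next
  assume "x = m"
  with \<open>a > 0\<close> show "is_arg_max f (\<lambda>_. True) x"
    by (simp add: is_arg_max_def f not_less)
qed

text \<open>First-order condition: marginal cost equals \<open>pr\<close>, divided through by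
  \<open>c j\<close>. The price \<open>pd\<close> only multiplies the dispatch fixed by the policy,
  so it shifts the profit by a constant and drops out.\<close>

lemma generator_optimal_iff:
  assumes "c j > 0"
  shows "is_arg_max (gen_profit G c br D pd pr j) (\<lambda>_. True) \<beta> \<longleftrightarrow>
    inverse (c j) * D / (\<Sum>k\<in>G. inverse (c k)) + rt_supply br pr \<beta> = inverse (c j) * pr"
proof -
  define gd where "gd = inverse (c j) * D / (\<Sum>k\<in>G. inverse (c k))"
  \<comment> \<open>The bid at which total dispatch \<open>gd + (br * pr - m)\<close> equals
    \<open>inverse (c j) * pr\<close>; it is the vertex of the profit parabola.\<close>
  define m where "m = gd + br * pr - inverse (c j) * pr"
  have complete_square: "gen_profit G c br D pd pr j y =
      (pd * gd - pr * gd + pr\<^sup>2 / (2 * c j)) - c j / 2 * (y - m)\<^sup>2" for y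
    using assms unfolding gen_profit_def rt_supply_def m_def Let_def gd_def[symmetric]
    by (simp add: field_simps power2_eq_square)
  have "is_arg_max (gen_profit G c br D pd pr j) (\<lambda>_. True) \<beta> \<longleftrightarrow> \<beta> = m"
    by (rule is_arg_max_concave_quadratic_iff[OF _ complete_square]) (use assms in simp)
  then show ?thesis
    unfolding gd_def[symmetric] m_def rt_supply_def by auto
qed

text \<open>The payment has constant slope \<open>pd - pr\<close> on the whole real line, hence has
  no minimum unless the slope vanishes; then every \<open>y\<close> is optimal, which is why
  \<open>y\<close> is absent on the right.\<close>

lemma load_optimal_iff:
  "is_arg_min (load_payment pd pr \<delta>) (\<lambda>_. True) y \<longleftrightarrow> pd = pr"
proof
  assume opt: "is_arg_min (load_payment pd pr \<delta>) (\<lambda>_. True) y"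
  \<comment> \<open>Moving against the slope by \<open>pd - pr\<close> changes the payment by
    exactly \<open>-(pd - pr)\<^sup>2\<close>.\<close>
  have "\<not> load_payment pd pr \<delta> (y - (pd - pr)) < load_payment pd pr \<delta> y"
    using opt by (simp add: is_arg_min_def)
  then have "(pd - pr)\<^sup>2 \<le> 0"
    by (simp add: load_payment_def algebra_simps power2_eq_square)
  then show "pd = pr"
    by simp
next
  assume "pd = pr"
  then show "is_arg_min (load_payment pd pr \<delta>) (\<lambda>_. True) y"
    by (simp add: is_arg_min_def load_payment_def algebra_simps)
qed

theorem theorem6:
  fixes G :: "'g set" and L :: "'l set"
    and c :: "'g \<Rightarrow> real" and dem :: "'l \<Rightarrow> real" and br d :: real
  assumes "finite G" and "G \<noteq> {}" and "finite L" and "L \<noteq> {}"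
    and "\<And>j. j \<in> G \<Longrightarrow> c j > 0"
    and "\<And>l. l \<in> L \<Longrightarrow> dem l > 0"
    and "br > 0"
    and "d = (\<Sum>l\<in>L. dem l)"
  shows "(\<exists>x :: ('g, 'l) market_outcome. competitive_equilibrium G L c dem br x) \<and>
    (\<forall>x :: ('g, 'l) market_outcome. competitive_equilibrium G L c dem br x \<longleftrightarrow>
       (\<forall>j\<in>G. gen_da x j = inverse (c j) / (\<Sum>k\<in>G. inverse (c k)) * d \<and>
              gen_rt x j = 0 \<and>
              bid_rt x j = br / (\<Sum>k\<in>G. inverse (c k)) * d) \<and>
       (\<forall>l\<in>L. load_da x l + load_rt x l = dem l) \<and>
       (\<Sum>l\<in>L. load_da x l) = d \<and>
       (\<Sum>l\<in>L. load_rt x l) = 0 \<and>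
       price_da x = d / (\<Sum>k\<in>G. inverse (c k)) \<and>
       price_rt x = d / (\<Sum>k\<in>G. inverse (c k)))"
proof -
  define S where "S = (\<Sum>k\<in>G. inverse (c k))"
  have "S > 0"
    unfolding S_def using assms(1,2,5) by (intro sum_pos) auto
  have characterization: "competitive_equilibrium G L c dem br x \<longleftrightarrow>
       (\<forall>j\<in>G. gen_da x j = inverse (c j) / S * d \<and> gen_rt x j = 0 \<and> bid_rt x j = br / S * d) \<and>
       (\<forall>l\<in>L. load_da x l + load_rt x l = dem l) \<and>
       (\<Sum>l\<in>L. load_da x l) = d \<and> (\<Sum>l\<in>L. load_rt x l) = 0 \<and>
       price_da x = d / S \<and> price_rt x = d / S"
    (is "_ \<longleftrightarrow> ?explicit x") for x :: "('g, 'l) market_outcome"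
  proof
    assume eq: "competitive_equilibrium G L c dem br x"
    \<comment> \<open>Loads choose their day-ahead demand freely, so its total is kept apart from
      \<open>d\<close> until real-time balance identifies the two.\<close>
    define D where "D = (\<Sum>l\<in>L. load_da x l)"
    have opt: "inverse (c j) * D / S + rt_supply br (price_rt x) (bid_rt x j)
        = inverse (c j) * price_rt x" if "j \<in> G" for j
    proof -
      have "is_arg_max (gen_profit G c br D (price_da x) (price_rt x) j) (\<lambda>_. True) (bid_rt x j)"
        using eq that by (simp add: competitive_equilibrium_def D_def)
      then show ?thesis
        using assms(5)[OF that] by (simp add: generator_optimal_iff S_def)
    qed
    \<comment> \<open>\<open>L\<close> is nonempty, so at least one load imposes equality of the
      prices.\<close>
    have prices: "price_da x = price_rt x"
      using eq assms(4) by (auto simp: competitive_equilibrium_def load_optimal_iff)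
    have load: "load_rt x l = dem l - load_da x l" if "l \<in> L" for l
      using eq that by (simp add: competitive_equilibrium_def)
    have da: "gen_da x j = inverse (c j) * price_da x" if "j \<in> G" for j
      using eq that by (simp add: competitive_equilibrium_def mpm_day_ahead_def)
    have "S * price_da x = (\<Sum>j\<in>G. gen_da x j)"
      by (simp add: da S_def sum_distrib_right)
    also have "\<dots> = D"
      using eq unfolding competitive_equilibrium_def mpm_day_ahead_def D_def by blast
    finally have price: "price_da x = D / S"
      using \<open>S > 0\<close> by (simp add: field_simps)
    \<comment> \<open>With both prices equal to \<open>D / S\<close>, the day-ahead dispatch already
      satisfies the first-order condition in \<open>opt\<close>.\<close>
    have no_supply: "rt_supply br (price_rt x) (bid_rt x j) = 0" if "j \<in> G" for j
      using opt[OF that] by (simp add: prices[symmetric] price)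
    have rt: "gen_rt x j = 0" if "j \<in> G" for j
      using eq that no_supply[OF that] by (simp add: competitive_equilibrium_def rt_clearing_def)
    have rt_sum: "(\<Sum>l\<in>L. load_rt x l) = 0"
    proof -
      have "(\<Sum>l\<in>L. load_rt x l) = (\<Sum>j\<in>G. rt_supply br (price_rt x) (bid_rt x j))"
        using eq unfolding competitive_equilibrium_def rt_clearing_def by metis
      then show ?thesis
        using no_supply by (metis (no_types, lifting) sum.neutral)
    qed
    \<comment> \<open>Summed over the loads, real-time demand is \<open>d - D\<close>.\<close>
    have "D = d"
      using rt_sum by (simp add: load sum_subtractf D_def assms(8))
    have bid: "bid_rt x j = br / S * d" if "j \<in> G" for j
      using no_supply[OF that]
      by (simp add: rt_supply_def prices[symmetric] price \<open>D = d\<close>)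
    show "?explicit x"
      using \<open>D = d\<close> da rt bid load rt_sum D_def
      by (simp add: prices[symmetric] price)
  next
    assume x: "?explicit x"
    then have no_supply: "rt_supply br (price_rt x) (bid_rt x j) = 0" if "j \<in> G" for j
      using that by (simp add: rt_supply_def)
    have "(\<Sum>j\<in>G. gen_da x j) = (\<Sum>j\<in>G. inverse (c j)) * (d / S)"
      using x by (simp add: sum_distrib_right sum_divide_distrib)
    also have "\<dots> = d"
      using \<open>S > 0\<close> by (simp add: S_def[symmetric])
    finally have "mpm_day_ahead G L c x"
      using x by (simp add: mpm_day_ahead_def)
    moreover have "rt_clearing G L br x"
      using x no_supply by (simp add: rt_clearing_def)
    \<comment> \<open>With zero real-time supply, both sides of the first-order condition are
      \<open>inverse (c j) * d / S\<close>.\<close>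
    moreover have "is_arg_max
        (gen_profit G c br (\<Sum>l\<in>L. load_da x l) (price_da x) (price_rt x) j)
        (\<lambda>_. True) (bid_rt x j)" if "j \<in> G" for j
      using x no_supply[OF that] assms(5)[OF that]
      by (simp add: generator_optimal_iff S_def[symmetric])
    moreover have "load_rt x l = dem l - load_da x l" if "l \<in> L" for l
      using x that by (simp add: eq_diff_eq add.commute)
    ultimately show "competitive_equilibrium G L c dem br x"
      using x by (simp add: competitive_equilibrium_def load_optimal_iff)
  qed
  \<comment> \<open>Equilibrium fixes only the total of the day-ahead demands; the witness lets each
    load buy all of its demand day-ahead.\<close>
  define x :: "('g, 'l) market_outcome" where
    "x = \<lparr>gen_da = \<lambda>j. inverse (c j) / S * d, gen_rt = \<lambda>_. 0, bid_rt = \<lambda>_. br / S * d,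
          load_da = dem, load_rt = \<lambda>_. 0, price_da = d / S, price_rt = d / S\<rparr>"
  have "competitive_equilibrium G L c dem br x"
    unfolding characterization by (simp add: x_def assms(8))
  then show ?thesis
    using characterization unfolding S_def by blast
qed

end
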